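(* Let $F$ be a field and let $k$ be its prime subfield. (1) If $F = k$, then additivity implies homogeneity: for all vector spaces $U$, $V$ over $F$, every additive mapping $\varphi\colon U\to V$ is $F$-homogeneous (and therefore $F$-linear). (2) If $F \neq k$, then additivity does not imply homogeneity: there exist vector spaces $U$ and $V$ over $F$ and an additive mapping $\varphi\colon U\to V$ which is not $F$-homogeneous (and therefore not $F$-linear).
   Context: The prime subfield of a field $F$ is the smallest subfield of $F$. For vector spaces $U$, $V$ over $F$, a mapping $\varphi\colon U\to V$ is called additive if $\varphi(u_1+u_2)=\varphi(u_1)+\varphi(u_2)$ for all $u_1,u_2\in U$; it is called $F$-homogeneous if $\varphi(\lambda u)=\lambda\varphi(u)$ for every $u\in U$ and every $\lambda\in F$; it is $F$-linear if it is both additive and $F$-homogeneous. The Axiom of Choice is assumed. *)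

theory Defs
  imports "HOL-Algebra.Algebra"
begin

text \<open>
  Fields are those of HOL-Algebra (carrier sets in records), and a vector space over a field \<open>F\<close>
  is a \<open>module F U\<close>.
\<close>

definition prime_subfield :: "('f, 'r) ring_scheme \<Rightarrow> 'f set" where
  "prime_subfield F = \<Inter>{K. subfield K F}"

text \<open>
  The intersection of all subfields is itself a subfield, so it is the smallest one.
\<close>

lemma prime_subfield_subset: "subfield K F \<Longrightarrow> prime_subfield F \<subseteq> K"
  unfolding prime_subfield_def by auto

lemma (in field) subfield_prime_subfield: "subfield (prime_subfield R) R"
proof (rule subfieldI')
  show "subring (prime_subfield R) R"
    unfolding prime_subfield_def
    using carrier_is_subfield by (intro subring_Inter) (auto dest: subfieldE(1))
  show "inv x \<in> prime_subfield R" if "x \<in> prime_subfield R - {\<zero>}" for x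
    using that subfield_m_inv(1) unfolding prime_subfield_def by blast
qed

definition additive_map ::
    "('f, 'u, 'm) module_scheme \<Rightarrow> ('f, 'v, 'n) module_scheme \<Rightarrow> ('u \<Rightarrow> 'v) \<Rightarrow> bool" where
  "additive_map U V \<phi> \<longleftrightarrow>
     \<phi> \<in> carrier U \<rightarrow> carrier V \<and>
     (\<forall>x\<in>carrier U. \<forall>y\<in>carrier U. \<phi> (x \<oplus>\<^bsub>U\<^esub> y) = \<phi> x \<oplus>\<^bsub>V\<^esub> \<phi> y)"

definition homogeneous_map ::
    "('f, 'r) ring_scheme \<Rightarrow> ('f, 'u, 'm) module_scheme \<Rightarrow> ('f, 'v, 'n) module_scheme
       \<Rightarrow> ('u \<Rightarrow> 'v) \<Rightarrow> bool" where
  "homogeneous_map F U V \<phi> \<longleftrightarrow>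
     \<phi> \<in> carrier U \<rightarrow> carrier V \<and>
     (\<forall>c\<in>carrier F. \<forall>x\<in>carrier U. \<phi> (c \<odot>\<^bsub>U\<^esub> x) = c \<odot>\<^bsub>V\<^esub> \<phi> x)"

definition linear_map ::
    "('f, 'r) ring_scheme \<Rightarrow> ('f, 'u, 'm) module_scheme \<Rightarrow> ('f, 'v, 'n) module_scheme
       \<Rightarrow> ('u \<Rightarrow> 'v) \<Rightarrow> bool" where
  "linear_map F U V \<phi> \<longleftrightarrow> additive_map U V \<phi> \<and> homogeneous_map F U V \<phi>"

end

theory Submission
  imports Defs
begin

text \<open>
  (1) For a fixed additive \<open>\<phi>\<close>, consider the scalars \<open>c\<close> that \<open>\<phi>\<close> respects, that is, for which
  \<open>\<phi> (c x) = c (\<phi> x)\<close> for all \<open>x\<close>. Additivity makes them closed under sums and negation,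
  composition gives products, and \<open>x = c (c\<inverse> x)\<close> gives inverses. They form a subfield, which
  therefore contains the prime subfield (lemma \<open>subfield_respected_scalars\<close>).

  (2) Take both spaces to be \<open>F\<close> itself. An \<open>F\<close>-homogeneous endomap of \<open>F\<close> is multiplication by
  its value at \<open>\<one>\<close>, so if it fixes \<open>\<one>\<close> then it is the identity and its image is all of \<open>F\<close>. Hence
  it suffices to have an additive \<open>\<phi>\<close> that fixes \<open>\<one>\<close> and takes values in a proper subfield \<open>K\<close>.
  Such a \<open>\<phi>\<close> is the projection onto \<open>K\<close> along a \<open>K\<close>-subspace complementary to \<open>K\<close>. The complement
  comes from Zorn's lemma, as a \<open>K\<close>-subspace maximal among those that avoid \<open>\<one>\<close>
  (lemma \<open>complement_of_subfield\<close>); this takes the place of extending \<open>{\<one>}\<close> to a basis of \<open>F\<close> over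
  \<open>K\<close>. The statement follows with \<open>K\<close> the prime subfield.
\<close>

section \<open>Scalars respected by an additive map\<close>

definition respected_scalars ::
    "('f, 'r) ring_scheme \<Rightarrow> ('f, 'u, 'm) module_scheme \<Rightarrow> ('f, 'v, 'n) module_scheme
       \<Rightarrow> ('u \<Rightarrow> 'v) \<Rightarrow> 'f set" where
  "respected_scalars F U V \<phi> =
     {c \<in> carrier F. \<forall>x\<in>carrier U. \<phi> (c \<odot>\<^bsub>U\<^esub> x) = c \<odot>\<^bsub>V\<^esub> \<phi> x}"

lemma additive_map_a_inv:
  assumes "abelian_group U" "abelian_group V" "additive_map U V \<phi>" "x \<in> carrier U"
  shows "\<phi> (\<ominus>\<^bsub>U\<^esub> x) = \<ominus>\<^bsub>V\<^esub> \<phi> x"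
proof -
  have "group_hom (add_monoid U) (add_monoid V) \<phi>"
    using assms
    by (auto simp: group_hom_def group_hom_axioms_def hom_def additive_map_def abelian_group.a_group)
  from group_hom.hom_inv[OF this] show ?thesis
    using assms(4) by (simp add: a_inv_def)
qed

lemma subfield_respected_scalars:
  assumes F: "field F" and U: "module F U" and V: "module F V" and \<phi>: "additive_map U V \<phi>"
  shows "subfield (respected_scalars F U V \<phi>) F"
proof -
  interpret F: field F by fact
  interpret U: module F U by fact
  interpret V: module F V by fact
  note mem = respected_scalars_def
  have closed: "\<phi> x \<in> carrier V" if "x \<in> carrier U" for x
    using \<phi> that by (auto simp: additive_map_def)
  have add: "\<phi> (x \<oplus>\<^bsub>U\<^esub> y) = \<phi> x \<oplus>\<^bsub>V\<^esub> \<phi> y" if "x \<in> carrier U" "y \<in> carrier U" for x y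
    using \<phi> that by (auto simp: additive_map_def)
  have neg: "\<phi> (\<ominus>\<^bsub>U\<^esub> x) = \<ominus>\<^bsub>V\<^esub> \<phi> x" if "x \<in> carrier U" for x
    using additive_map_a_inv[OF U.abelian_group_axioms V.abelian_group_axioms \<phi> that] .
  show ?thesis
  proof (rule F.subfieldI'[OF F.subringI])
    fix c assume c: "c \<in> respected_scalars F U V \<phi> - {\<zero>\<^bsub>F\<^esub>}"
    then have cF: "c \<in> carrier F" and c0: "c \<noteq> \<zero>\<^bsub>F\<^esub>"
      and resp: "\<And>x. x \<in> carrier U \<Longrightarrow> \<phi> (c \<odot>\<^bsub>U\<^esub> x) = c \<odot>\<^bsub>V\<^esub> \<phi> x"
      by (auto simp: mem)
    have u: "c \<in> Units F" using cF c0 F.field_Units by blast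
    then have iF: "inv\<^bsub>F\<^esub> c \<in> carrier F" by simp
    have "\<phi> (inv\<^bsub>F\<^esub> c \<odot>\<^bsub>U\<^esub> x) = inv\<^bsub>F\<^esub> c \<odot>\<^bsub>V\<^esub> \<phi> x" if x: "x \<in> carrier U" for x
    proof -
      let ?y = "inv\<^bsub>F\<^esub> c \<odot>\<^bsub>U\<^esub> x"
      have y: "?y \<in> carrier U" using iF x by simp
      have "c \<odot>\<^bsub>U\<^esub> ?y = x"
        using u cF iF x by (simp flip: U.smult_assoc1)
      then have "\<phi> x = c \<odot>\<^bsub>V\<^esub> \<phi> ?y" using resp[OF y] by simp
      then show ?thesis
        using u cF iF closed[OF y] by (simp flip: V.smult_assoc1)
    qed
    then show "inv\<^bsub>F\<^esub> c \<in> respected_scalars F U V \<phi>"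
      using iF by (simp add: mem)
  qed (auto simp: mem closed add neg U.smult_l_distr V.smult_l_distr U.smult_l_minus
         V.smult_l_minus U.smult_assoc1 V.smult_assoc1)
qed

section \<open>Projecting onto a subfield\<close>

text \<open>
  Maximality among the \<open>K\<close>-subspaces that avoid \<open>\<one>\<close> yields a complement: if \<open>x \<notin> W\<close> then \<open>\<one>\<close> lies
  in the strictly larger subspace \<open>K x + W\<close>, and in \<open>\<one> = c x + w\<close> the scalar \<open>c\<close> is nonzero because
  \<open>\<one> \<notin> W\<close>, so the equation can be solved for \<open>x\<close>.
\<close>

lemma (in ring) complement_of_subfield:
  assumes K: "subfield K R"
  obtains W where "subgroup W (add_monoid R)" "K \<inter> W = {\<zero>}"
    "\<And>x. x \<in> carrier R \<Longrightarrow> \<exists>c\<in>K. x \<ominus> c \<in> W"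
proof -
  define \<W> where "\<W> = {W. subgroup W (add_monoid R) \<and> (\<forall>k\<in>K. \<forall>w\<in>W. k \<otimes> w \<in> W) \<and> \<one> \<notin> W}"
  note subring_props = subringE[OF subfieldE(1)[OF K]]
  have KR: "k \<in> carrier R" if "k \<in> K" for k using that subring_props(1) by blast
  have "{\<zero>} \<in> \<W>"
    using subfieldE(6)[OF K] KR normal_imp_subgroup[OF add.one_is_normal]
    by (auto simp: \<W>_def)
  then have "\<W> \<noteq> {}" by blast
  moreover have "\<Union>\<C> \<in> \<W>" if ne: "\<C> \<noteq> {}" and ch: "subset.chain \<W> \<C>" for \<C>
  proof -
    have sub: "\<C> \<subseteq> \<W>" and total: "\<And>A B. A \<in> \<C> \<Longrightarrow> B \<in> \<C> \<Longrightarrow> A \<subseteq> B \<or> B \<subseteq> A"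
      using ch by (auto simp: subset_chain_def)
    have sg: "subgroup W (add_monoid R)" if "W \<in> \<C>" for W
      using that sub by (auto simp: \<W>_def)
    have "subgroup (\<Union>\<C>) (add_monoid R)"
    proof (rule add.subgroupI)
      show "\<Union>\<C> \<subseteq> carrier R" using add.subgroupE(1)[OF sg] by blast
      show "\<Union>\<C> \<noteq> {}" using ne add.subgroupE(2)[OF sg] by blast
      show "\<ominus> a \<in> \<Union>\<C>" if "a \<in> \<Union>\<C>" for a
        using that add.subgroupE(3)[OF sg] by blast
      fix a b assume "a \<in> \<Union>\<C>" "b \<in> \<Union>\<C>"
      then obtain A B where "A \<in> \<C>" "a \<in> A" "B \<in> \<C>" "b \<in> B" by blast
      then obtain C where "C \<in> \<C>" "a \<in> C" "b \<in> C" using total by blast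
      then show "a \<oplus> b \<in> \<Union>\<C>" using add.subgroupE(4)[OF sg] by blast
    qed
    then show ?thesis using sub by (auto simp: \<W>_def)
  qed
  ultimately obtain W where W: "W \<in> \<W>" and maximal: "\<And>V. V \<in> \<W> \<Longrightarrow> W \<subseteq> V \<Longrightarrow> V = W"
    using subset_Zorn_nonempty[of \<W>] by blast
  have sg: "subgroup W (add_monoid R)" and stable: "\<And>k w. k \<in> K \<Longrightarrow> w \<in> W \<Longrightarrow> k \<otimes> w \<in> W"
    and avoid: "\<one> \<notin> W"
    using W by (auto simp: \<W>_def)
  note Wgrp = add.subgroupE[OF sg]
  have W0: "\<zero> \<in> W" using subgroup.one_closed[OF sg] by simp
  have WR: "w \<in> carrier R" if "w \<in> W" for w using Wgrp(1) that by auto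
  have disjoint: "K \<inter> W = {\<zero>}"
  proof -
    have "k = \<zero>" if "k \<in> K" "k \<in> W" for k
    proof (rule ccontr)
      assume "k \<noteq> \<zero>"
      then have "inv k \<in> K" "inv k \<otimes> k = \<one>" using subfield_m_inv[OF K, of k] that by auto
      then show False using stable[of "inv k" k] that avoid by simp
    qed
    then show ?thesis using W0 subring_props(2) by blast
  qed
  have covers: "\<exists>c\<in>K. x \<ominus> c \<in> W" if x: "x \<in> carrier R" for x
  proof (cases "x \<in> W")
    case True
    then show ?thesis using x subring_props(2) by (auto intro!: bexI[of _ \<zero>] simp: minus_eq)
  next
    case False
    let ?V = "line_extension K x W"
    have "W \<subseteq> ?V"
    proof
      fix w assume w: "w \<in> W"
      then have "w = \<zero> \<otimes> x \<oplus> w" using x WR by simp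
      then show "w \<in> ?V" using w subring_props(2) line_extension_mem_iff by blast
    qed
    moreover have "x \<in> ?V"
    proof -
      have "x = \<one> \<otimes> x \<oplus> \<zero>" using x by simp
      then show ?thesis using W0 subring_props(3) line_extension_mem_iff by blast
    qed
    ultimately have "?V \<notin> \<W>" using maximal False by blast
    moreover have "subgroup ?V (add_monoid R)"
      using line_extension_is_subgroup[OF K sg x] .
    moreover have "k \<otimes> u \<in> ?V" if "k \<in> K" "u \<in> ?V" for k u
      using line_extension_smult_closed[OF K stable _ x that] WR by blast
    ultimately have "\<one> \<in> ?V" by (auto simp: \<W>_def)
    then obtain c w where c: "c \<in> K" and w: "w \<in> W" and eq: "\<one> = c \<otimes> x \<oplus> w"
      using line_extension_mem_iff by blast
    have "c \<noteq> \<zero>"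
    proof
      assume "c = \<zero>"
      then have "\<one> = w" using eq x WR[OF w] by simp
      then show False using w avoid by simp
    qed
    then have d: "inv c \<in> K" and dc: "inv c \<otimes> c = \<one>"
      using subfield_m_inv[OF K, of c] c by auto
    have R: "c \<in> carrier R" "inv c \<in> carrier R" "w \<in> carrier R" using c d w KR WR by auto
    \<comment> \<open>Dividing \<open>\<one> = c x + w\<close> by \<open>c\<close> shows that the \<open>K\<close>-component of \<open>x\<close> is \<open>c\<inverse>\<close>.\<close>
    have "inv c = inv c \<otimes> (c \<otimes> x \<oplus> w)" using R by (simp flip: eq)
    also have "\<dots> = x \<oplus> inv c \<otimes> w"
      using R x dc by (simp add: r_distr flip: m_assoc)
    finally have "x \<ominus> inv c = x \<ominus> (x \<oplus> inv c \<otimes> w)" by simp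
    also have "\<dots> = \<ominus> (inv c \<otimes> w)" using R x by algebra
    finally have "x \<ominus> inv c \<in> W" using Wgrp(3)[OF stable[OF d w]] by simp
    then show ?thesis using d by blast
  qed
  show thesis using that[OF sg disjoint covers] .
qed

text \<open>
  The value at \<open>x\<close> is the \<open>K\<close>-component of \<open>x\<close>: the \<open>c \<in> K\<close> for which \<open>x - c\<close> lies in the complement.
  It is unique because two candidates differ by an element of both \<open>K\<close> and the complement, and
  uniqueness turns the closure of both summands under addition into additivity of the projection.
\<close>

lemma (in ring) additive_retraction_onto_subfield:
  assumes K: "subfield K R"
  obtains \<phi> where "\<phi> \<in> carrier R \<rightarrow> K"
    "\<And>x y. x \<in> carrier R \<Longrightarrow> y \<in> carrier R \<Longrightarrow> \<phi> (x \<oplus> y) = \<phi> x \<oplus> \<phi> y"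
    "\<And>k. k \<in> K \<Longrightarrow> \<phi> k = k"
proof -
  obtain W where sg: "subgroup W (add_monoid R)" and disjoint: "K \<inter> W = {\<zero>}"
    and covers: "\<And>x. x \<in> carrier R \<Longrightarrow> \<exists>c\<in>K. x \<ominus> c \<in> W"
    using complement_of_subfield[OF K] by blast
  note subring_props = subringE[OF subfieldE(1)[OF K]]
  note Wgrp = add.subgroupE[OF sg]
  have KR: "k \<in> carrier R" if "k \<in> K" for k using that subring_props(1) by blast
  have unique: "c = d"
    if "x \<in> carrier R" "c \<in> K" "d \<in> K" "x \<ominus> c \<in> W" "x \<ominus> d \<in> W" for x c d
  proof -
    have R: "c \<in> carrier R" "d \<in> carrier R" using that KR by auto
    have "c \<ominus> d = (x \<ominus> d) \<oplus> \<ominus> (x \<ominus> c)" using R \<open>x \<in> carrier R\<close> by algebra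
    then have "c \<ominus> d \<in> W" using that Wgrp(3,4) by simp
    moreover have "c \<ominus> d \<in> K" using that subring_props(5,7) by (simp add: minus_eq)
    ultimately have "c \<ominus> d = \<zero>" using disjoint by blast
    then show ?thesis using R by simp
  qed
  define \<phi> where "\<phi> x = (SOME c. c \<in> K \<and> x \<ominus> c \<in> W)" for x
  have \<phi>: "\<phi> x \<in> K" "x \<ominus> \<phi> x \<in> W" if "x \<in> carrier R" for x
    using someI_ex[of "\<lambda>c. c \<in> K \<and> x \<ominus> c \<in> W"] covers[OF that] unfolding \<phi>_def by blast+
  show thesis
  proof
    show "\<phi> \<in> carrier R \<rightarrow> K" using \<phi> by blast
  next
    fix x y assume xy: "x \<in> carrier R" "y \<in> carrier R"
    have "(x \<oplus> y) \<ominus> (\<phi> x \<oplus> \<phi> y) = (x \<ominus> \<phi> x) \<oplus> (y \<ominus> \<phi> y)"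
      using xy \<phi>(1) KR by algebra
    then have "(x \<oplus> y) \<ominus> (\<phi> x \<oplus> \<phi> y) \<in> W" using xy \<phi>(2) Wgrp(4) by simp
    moreover have "x \<oplus> y \<in> carrier R" "\<phi> x \<oplus> \<phi> y \<in> K"
      using xy \<phi>(1) subring_props(7) by auto
    ultimately show "\<phi> (x \<oplus> y) = \<phi> x \<oplus> \<phi> y"
      by (metis unique \<phi>)
  next
    fix k assume k: "k \<in> K"
    have "k \<ominus> k \<in> W"
      using KR[OF k] subgroup.one_closed[OF sg] by (simp add: minus_eq r_neg)
    then show "\<phi> k = k" using k KR[OF k] by (metis unique \<phi>)
  qed
qed

section \<open>Additivity against homogeneity\<close>

definition self_module :: "('f, 'r) ring_scheme \<Rightarrow> ('f, 'f) module" where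
  "self_module F =
     \<lparr>carrier = carrier F, monoid.mult = monoid.mult F, one = one F, ring.zero = ring.zero F,
      add = add F, smult = monoid.mult F\<rparr>"

lemma self_module_simps [simp]:
  "carrier (self_module F) = carrier F" "ring.zero (self_module F) = ring.zero F"
  "add (self_module F) = add F" "smult (self_module F) = monoid.mult F"
  by (simp_all add: self_module_def)

lemma (in cring) module_self_module: "module R (self_module R)"
proof (rule moduleI)
  show "abelian_group (self_module R)"
    by (rule abelian_groupI) (auto simp: a_ac intro: l_neg)
qed (auto simp: l_distr r_distr m_assoc intro: is_cring)

theorem theorem2p1:
  fixes F :: "('f, 'r) ring_scheme"
  assumes "field F"
  shows "(carrier F = prime_subfield F \<longrightarrow>
            (\<forall>(U :: ('f, 'u, 'm) module_scheme) (V :: ('f, 'v, 'n) module_scheme) \<phi>.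
               module F U \<longrightarrow> module F V \<longrightarrow> additive_map U V \<phi> \<longrightarrow>
                 homogeneous_map F U V \<phi> \<and> linear_map F U V \<phi>))
       \<and> (carrier F \<noteq> prime_subfield F \<longrightarrow>
            (\<exists>(U :: ('f, 'f) module) (V :: ('f, 'f) module) \<phi>.
               module F U \<and> module F V \<and> additive_map U V \<phi> \<and>
                 \<not> homogeneous_map F U V \<phi> \<and> \<not> linear_map F U V \<phi>))"
proof (intro conjI impI allI)
  fix U :: "('f, 'u, 'm) module_scheme" and V :: "('f, 'v, 'n) module_scheme" and \<phi>
  assume prime: "carrier F = prime_subfield F" and U: "module F U" and V: "module F V"
    and \<phi>: "additive_map U V \<phi>"
  have "carrier F \<subseteq> respected_scalars F U V \<phi>"
    using prime_subfield_subset[OF subfield_respected_scalars[OF assms U V \<phi>]] prime by simp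
  then show hom: "homogeneous_map F U V \<phi>"
    using \<phi> by (auto simp: homogeneous_map_def respected_scalars_def additive_map_def)
  show "linear_map F U V \<phi>" using hom \<phi> by (simp add: linear_map_def)
next
  assume proper: "carrier F \<noteq> prime_subfield F"
  interpret F: field F by fact
  let ?K = "prime_subfield F"
  have K: "subfield ?K F" by (rule F.subfield_prime_subfield)
  obtain \<phi> where into: "\<phi> \<in> carrier F \<rightarrow> ?K"
    and add: "\<And>x y. x \<in> carrier F \<Longrightarrow> y \<in> carrier F \<Longrightarrow> \<phi> (x \<oplus>\<^bsub>F\<^esub> y) = \<phi> x \<oplus>\<^bsub>F\<^esub> \<phi> y"
    and fixes_K: "\<And>k. k \<in> ?K \<Longrightarrow> \<phi> k = k"
    using F.additive_retraction_onto_subfield[OF K] by blast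
  let ?S = "self_module F"
  have additive: "additive_map ?S ?S \<phi>"
    using into add subfieldE(3)[OF K] by (auto simp: additive_map_def)
  have "\<not> homogeneous_map F ?S ?S \<phi>"
  proof
    assume hom: "homogeneous_map F ?S ?S \<phi>"
    have one: "\<phi> \<one>\<^bsub>F\<^esub> = \<one>\<^bsub>F\<^esub>" using fixes_K subringE(3)[OF subfieldE(1)[OF K]] .
    have "c \<in> ?K" if c: "c \<in> carrier F" for c
    proof -
      have "\<phi> (c \<otimes>\<^bsub>F\<^esub> \<one>\<^bsub>F\<^esub>) = c \<otimes>\<^bsub>F\<^esub> \<phi> \<one>\<^bsub>F\<^esub>"
        using hom c F.one_closed unfolding homogeneous_map_def self_module_simps by blast
      then have "\<phi> c = c" using c one by simp
      then show ?thesis using funcset_mem[OF into c] by simp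
    qed
    then show False using proper subfieldE(3)[OF K] by blast
  qed
  then show "\<exists>(U :: ('f, 'f) module) (V :: ('f, 'f) module) \<phi>.
               module F U \<and> module F V \<and> additive_map U V \<phi> \<and>
                 \<not> homogeneous_map F U V \<phi> \<and> \<not> linear_map F U V \<phi>"
    using F.module_self_module additive unfolding linear_map_def by blast
qed

end
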